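(* Let $G$ be a connected amply regular graph of diameter $d\ge 4$ with parameters $(v,k,\lambda,\mu)$, where $\mu\neq 1$ and $\mu\ge\lambda$. Then $$d\le\left\lfloor\frac{2(k-2\mu)}{2+\left\lceil\frac{\lambda(\mu-\lambda)}{\mu-1}\right\rceil}\right\rfloor+4.$$
   Context: Graphs are simple and undirected. A $k$-regular graph $G$ with $v$ vertices ($v$ finite) is called an amply regular graph with parameters $(v,k,\lambda,\mu)$ if any two adjacent vertices have exactly $\lambda$ common neighbors, and any two vertices at distance $2$ have exactly $\mu$ common neighbors. *)

theory Defs
  imports "Graph_Theory.Graph_Theory"
begin

text \<open>
  A finite simple undirected graph is an instance of the locale \<^locale>\<open>graph\<close>: a finite
  symmetric digraph without loops and multiple arcs, in which an undirected edge is a pair of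
  opposite arcs. The relation \<open>u \<rightarrow>\<^bsub>G\<^esub> w\<close> is therefore adjacency, and the degree of a vertex is
  its \<^const>\<open>out_degree\<close>.
\<close>

definition common_neighbors :: "('a, 'b) pre_digraph \<Rightarrow> 'a \<Rightarrow> 'a \<Rightarrow> 'a set" where
  "common_neighbors G u w = {x \<in> verts G. u \<rightarrow>\<^bsub>G\<^esub> x \<and> w \<rightarrow>\<^bsub>G\<^esub> x}"

text \<open>The distance is \<open>\<infinity>\<close> if there is no walk from \<open>u\<close> to \<open>w\<close>.\<close>

definition graph_dist :: "('a, 'b) pre_digraph \<Rightarrow> 'a \<Rightarrow> 'a \<Rightarrow> enat" where
  "graph_dist G u w = (INF p \<in> {p. pre_digraph.awalk G u p w}. enat (length p))"

definition diameter :: "('a, 'b) pre_digraph \<Rightarrow> enat" where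
  "diameter G = (SUP u \<in> verts G. SUP w \<in> verts G. graph_dist G u w)"

locale amply_regular_graph = graph G
  for G :: "('a, 'b) pre_digraph" +
  fixes v k lam mu :: nat
  assumes order: "card (verts G) = v"
    and regular: "u \<in> verts G \<Longrightarrow> out_degree G u = k"
    and adjacent: "u \<rightarrow>\<^bsub>G\<^esub> w \<Longrightarrow> card (common_neighbors G u w) = lam"
    and distance_two: "\<lbrakk>u \<in> verts G; w \<in> verts G; graph_dist G u w = 2\<rbrakk> \<Longrightarrow>
      card (common_neighbors G u w) = mu"

text \<open>The distance is the library's shortest-path cost for unit weights.\<close>

lemma (in wf_digraph) ereal_of_enat_graph_dist:
  "ereal_of_enat (graph_dist G u w) = \<mu> (\<lambda>_. 1) u w"
proof (rule antisym)
  show "ereal_of_enat (graph_dist G u w) \<le> \<mu> (\<lambda>_. 1) u w"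
    unfolding \<mu>_def
  proof (rule INF_greatest)
    fix p assume "p \<in> {p. awalk u p w}"
    then have "graph_dist G u w \<le> enat (length p)"
      unfolding graph_dist_def by (rule INF_lower)
    then have "ereal_of_enat (graph_dist G u w) \<le> ereal_of_enat (enat (length p))"
      by (simp only: ereal_of_enat_le_iff)
    then show "ereal_of_enat (graph_dist G u w) \<le> ereal (awalk_cost (\<lambda>_. 1) p)"
      by (simp add: awalk_cost_def sum_list_triv)
  qed
next
  show "\<mu> (\<lambda>_. 1) u w \<le> ereal_of_enat (graph_dist G u w)"
  proof (cases "{p. awalk u p w} = {}")
    case True
    then show ?thesis unfolding graph_dist_def by (simp add: top_enat_def)
  next
    case False
    then have "Inf ((\<lambda>p. enat (length p)) ` {p. awalk u p w}) \<in> (\<lambda>p. enat (length p)) ` {p. awalk u p w}"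
      by (auto simp: Inf_enat_def intro: LeastI)
    then obtain p where p: "awalk u p w" "graph_dist G u w = enat (length p)"
      unfolding graph_dist_def by auto
    show ?thesis
      using min_cost_le_walk_cost[OF p(1), of "\<lambda>_. 1"] p(2)
      by (simp add: awalk_cost_def sum_list_triv)
  qed
qed

end

theory Submission
  imports Defs
begin

text \<open>
  Let \<open>f\<close> be the distance from one end of a diametral geodesic \<open>x 0, \<dots>, x d\<close>. For an edge \<open>x y\<close>
  with \<open>f y = f x + 1\<close>, sum \<open>f t - f z \<le> 1\<close> over the adjacent pairs of neighbours \<open>z \<noteq> y\<close> of \<open>x\<close>
  and \<open>t \<noteq> x\<close> of \<open>y\<close>. Vertices adjacent to exactly one of \<open>x\<close>, \<open>y\<close> lie in \<open>mu - 1\<close> such pairs on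
  their side, the \<open>lam\<close> common neighbours in \<open>lam - 1\<close> on either side, where their contributions
  cancel. Hence the Laplacian of \<open>f\<close> drops along the edge by at least
  \<open>2 + lam (mu - lam) / (mu - 1)\<close>, which may be rounded up since \<open>f\<close> is integral.
  The \<open>mu\<close> common neighbours of \<open>x 0\<close> and \<open>x 2\<close>, and of \<open>x (d - 2)\<close> and \<open>x d\<close>, bound
  the Laplacian by \<open>k - 2 mu\<close> from above at \<open>x 2\<close> and by \<open>- (k - 2 mu)\<close> from below at \<open>x (d - 2)\<close>,
  and there are \<open>d - 4\<close> steps in between.
\<close>

section \<open>Shortest walks and geodesics\<close>

lemma (in wf_digraph) graph_dist_le:
  assumes "awalk u p w"
  shows "graph_dist G u w \<le> enat (length p)"
  unfolding graph_dist_def using assms by (intro INF_lower) simp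

lemma (in wf_digraph) shortest_awalkE:
  assumes "graph_dist G u w = enat n"
  obtains p where "awalk u p w" "length p = n"
proof -
  have "{p. awalk u p w} \<noteq> {}"
    using assms by (auto simp: graph_dist_def Inf_enat_def split: if_splits)
  then have "Inf ((\<lambda>p. enat (length p)) ` {p. awalk u p w}) \<in> (\<lambda>p. enat (length p)) ` {p. awalk u p w}"
    by (auto simp: Inf_enat_def intro: LeastI)
  then show thesis
    using assms that by (auto simp: graph_dist_def)
qed

lemma (in wf_digraph) graph_dist_self:
  assumes "u \<in> verts G"
  shows "graph_dist G u u = 0"
  using graph_dist_le[of u "[]" u] assms by (simp add: awalk_Nil_iff flip: zero_enat_def)

lemma (in wf_digraph) graph_dist_eq_0D:
  assumes "graph_dist G u w = 0"
  shows "u = w"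
  using assms by (metis shortest_awalkE zero_enat_def length_0_conv awalk_Nil_iff)

lemma (in wf_digraph) graph_dist_step:
  assumes "x \<rightarrow>\<^bsub>G\<^esub> y" "graph_dist G u x = enat n"
  shows "graph_dist G u y \<le> enat (Suc n)"
proof -
  obtain p where p: "awalk u p x" "length p = n"
    using assms(2) by (rule shortest_awalkE)
  obtain e where "e \<in> arcs G" "tail G e = x" "head G e = y"
    using assms(1) by (auto simp: arcs_ends_def arc_to_ends_def)
  then have "awalk u (p @ [e]) y"
    using p(1) by (auto simp: awalk_simps)
  from graph_dist_le[OF this] show ?thesis using p(2) by simp
qed

text \<open>Dropping the last arc of a shortest walk leaves a walk of length \<open>n\<close>. It is
  itself shortest, for otherwise one step from its end would reach \<open>y\<close> too
  early.\<close>

lemma (in wf_digraph) graph_dist_predecessorE: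
  assumes "graph_dist G u y = enat (Suc n)"
  obtains x where "x \<rightarrow>\<^bsub>G\<^esub> y" "graph_dist G u x = enat n"
proof -
  obtain p where p: "awalk u p y" "length p = Suc n"
    using assms by (rule shortest_awalkE)
  then obtain q e where q: "p = q @ [e]"
    by (metis length_Suc_conv_rev)
  with p have w: "awalk u q (tail G e)" and e: "e \<in> arcs G" "head G e = y" and len: "length q = n"
    by (auto simp: awalk_simps)
  have adj: "tail G e \<rightarrow>\<^bsub>G\<^esub> y"
    using e by (metis in_arcs_imp_in_arcs_ends)
  obtain m where m: "graph_dist G u (tail G e) = enat m" "m \<le> n"
    using graph_dist_le[OF w] len by (cases "graph_dist G u (tail G e)") auto
  have "m = n"
    using graph_dist_step[OF adj m(1)] assms m(2) by simp
  with adj m(1) that show thesis by blast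
qed

lemma (in wf_digraph) geodesicE:
  assumes "graph_dist G u w = enat n"
  obtains x where "x n = w" "\<And>i. i \<le> n \<Longrightarrow> graph_dist G u (x i) = enat i"
    "\<And>i. i < n \<Longrightarrow> x i \<rightarrow>\<^bsub>G\<^esub> x (Suc i)"
  using assms
proof (induction n arbitrary: w thesis)
  case 0
  then show ?case by (intro "0.prems"(1)[of "\<lambda>_. w"]) auto
next
  case (Suc n)
  obtain y where y: "y \<rightarrow>\<^bsub>G\<^esub> w" "graph_dist G u y = enat n"
    using Suc.prems(2) by (rule graph_dist_predecessorE)
  obtain x where x: "x n = y" "\<And>i. i \<le> n \<Longrightarrow> graph_dist G u (x i) = enat i"
    "\<And>i. i < n \<Longrightarrow> x i \<rightarrow>\<^bsub>G\<^esub> x (Suc i)"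
    using Suc.IH y(2) by blast
  show ?case
    by (rule Suc.prems(1)[of "x(Suc n := w)"]) (use x y Suc.prems(2) in \<open>auto simp: less_Suc_eq le_Suc_eq\<close>)
qed

text \<open>Translates a purely local condition into the distance hypothesis under which
  \<open>mu\<close> is specified.\<close>

lemma (in wf_digraph) graph_dist_eq_2I:
  assumes "u \<rightarrow>\<^bsub>G\<^esub> x" "x \<rightarrow>\<^bsub>G\<^esub> w" "u \<noteq> w" "\<not> u \<rightarrow>\<^bsub>G\<^esub> w"
  shows "graph_dist G u w = 2"
proof -
  have u: "graph_dist G u u = enat 0"
    using graph_dist_self assms(1) adj_in_verts(1) by (auto simp: zero_enat_def)
  obtain m where m: "graph_dist G u x = enat m" "m \<le> 1"
    using graph_dist_step[OF assms(1) u] by (cases "graph_dist G u x") auto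
  obtain n where n: "graph_dist G u w = enat n" "n \<le> 2"
    using graph_dist_step[OF assms(2) m(1)] m(2) by (cases "graph_dist G u w") auto
  have "n \<noteq> 0"
    using n(1) assms(3) graph_dist_eq_0D by (metis zero_enat_def)
  moreover have "n \<noteq> 1"
  proof
    assume "n = 1"
    then obtain t where "t \<rightarrow>\<^bsub>G\<^esub> w" "graph_dist G u t = enat 0"
      using n(1) graph_dist_predecessorE[of u w 0] by auto
    then show False
      using assms(4) graph_dist_eq_0D by (auto simp: zero_enat_def)
  qed
  ultimately have "n = 2" using n(2) by simp
  with n(1) show ?thesis by (simp add: numeral_eq_enat)
qed

section \<open>Neighbourhoods and the Laplacian\<close>

definition nbrs :: "('a, 'b) pre_digraph \<Rightarrow> 'a \<Rightarrow> 'a set" where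
  "nbrs G u = {w. u \<rightarrow>\<^bsub>G\<^esub> w}"

text \<open>The sign is that of adjacency minus degree matrix, the negative of the positive
  semidefinite Laplacian.\<close>

definition laplacian :: "('a, 'b) pre_digraph \<Rightarrow> ('a \<Rightarrow> int) \<Rightarrow> 'a \<Rightarrow> int" where
  "laplacian G f u = (\<Sum>w\<in>nbrs G u. f w - f u)"

lemma (in wf_digraph) common_neighbors_eq: "common_neighbors G u w = nbrs G u \<inter> nbrs G w"
  by (auto simp: common_neighbors_def nbrs_def adj_in_verts)

context graph
begin

lemma adj_sym: "u \<rightarrow>\<^bsub>G\<^esub> w \<longleftrightarrow> w \<rightarrow>\<^bsub>G\<^esub> u"
  using graph_symmetric by blast

lemma not_adj_self: "\<not> u \<rightarrow>\<^bsub>G\<^esub> u"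
  using adj_not_same by blast

lemma finite_nbrs: "finite (nbrs G u)"
  by (rule finite_subset[OF _ finite_verts]) (auto simp: nbrs_def adj_in_verts)

lemma card_nbrs: "card (nbrs G u) = out_degree G u"
proof -
  have "bij_betw (head G) (out_arcs G u) (nbrs G u)"
    unfolding bij_betw_def
  proof
    show "inj_on (head G) (out_arcs G u)"
      by (auto simp: inj_on_def arc_to_ends_def intro!: no_multi_arcs)
    show "head G ` out_arcs G u = nbrs G u"
      by (force simp: nbrs_def arcs_ends_def arc_to_ends_def)
  qed
  then show ?thesis
    unfolding out_degree_def by (simp add: bij_betw_same_card)
qed

end

section \<open>Drop of the Laplacian along an edge\<close>

context amply_regular_graph
begin

lemma card_nbrs_eq: "u \<in> verts G \<Longrightarrow> card (nbrs G u) = k"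
  by (simp add: card_nbrs regular)

lemma card_common_nbrs_edge:
  assumes "u \<rightarrow>\<^bsub>G\<^esub> w"
  shows "card (nbrs G u \<inter> nbrs G w) = lam"
  using adjacent[OF assms] by (simp add: common_neighbors_eq)

lemma card_common_nbrs_nonedge:
  assumes "u \<rightarrow>\<^bsub>G\<^esub> x" "x \<rightarrow>\<^bsub>G\<^esub> w" "u \<noteq> w" "\<not> u \<rightarrow>\<^bsub>G\<^esub> w"
  shows "card (nbrs G u \<inter> nbrs G w) = mu"
  using distance_two[OF _ _ graph_dist_eq_2I[OF assms]] assms(1,2)
  by (auto simp: common_neighbors_eq adj_in_verts)

text \<open>The set counted consists of the common neighbours of \<open>z\<close> and
  \<open>y\<close> other than \<open>x\<close>, which is always one of them. Hence \<open>z\<close>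
  and \<open>y\<close> are either adjacent or at distance 2, and one is subtracted from
  \<open>lam\<close> or \<open>mu\<close>.\<close>

lemma card_nbrs_across_edge:
  assumes "x \<rightarrow>\<^bsub>G\<^esub> y" "z \<in> nbrs G x - {y}"
  shows "int (card {t \<in> nbrs G y - {x}. z \<rightarrow>\<^bsub>G\<^esub> t}) =
    (if z \<in> nbrs G y then int lam - 1 else int mu - 1)"
proof -
  have zx: "z \<rightarrow>\<^bsub>G\<^esub> x" and "y \<rightarrow>\<^bsub>G\<^esub> x" and "z \<noteq> y"
    using assms adj_sym by (auto simp: nbrs_def)
  then have x: "x \<in> nbrs G z \<inter> nbrs G y"
    by (auto simp: nbrs_def)
  have eq: "{t \<in> nbrs G y - {x}. z \<rightarrow>\<^bsub>G\<^esub> t} = nbrs G z \<inter> nbrs G y - {x}"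
    by (auto simp: nbrs_def)
  have fin: "finite (nbrs G z \<inter> nbrs G y)"
    using finite_nbrs by blast
  have "int (card (nbrs G z \<inter> nbrs G y - {x})) = int (card (nbrs G z \<inter> nbrs G y)) - 1"
    using card.remove[OF fin x] by simp
  moreover have "card (nbrs G z \<inter> nbrs G y) = (if z \<in> nbrs G y then lam else mu)"
    using card_common_nbrs_edge[of z y] card_common_nbrs_nonedge[of z x y] zx assms(1) \<open>z \<noteq> y\<close>
      adj_sym[of z y] by (auto simp: nbrs_def)
  ultimately show ?thesis
    unfolding eq by simp
qed

text \<open>The estimate is kept multiplied by \<open>mu - 1\<close>, so that the double count stays
  within the integers.\<close>

lemma laplacian_diff_edge:
  assumes xy: "x \<rightarrow>\<^bsub>G\<^esub> y" and fy: "f y = f x + 1"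
    and lip: "\<And>z t. z \<rightarrow>\<^bsub>G\<^esub> t \<Longrightarrow> f t \<le> f z + 1"
  shows "(int mu - 1) * (laplacian G f x - laplacian G f y)
    \<ge> 2 * (int mu - 1) + int lam * (int mu - int lam)"
proof -
  define A B D where "A = nbrs G x - {y}" and "B = nbrs G y - {x}" and "D = nbrs G x \<inter> nbrs G y"
  define r where "r z = (if z \<in> D then int lam - 1 else int mu - 1)" for z
  have yx: "y \<rightarrow>\<^bsub>G\<^esub> x" using xy adj_sym by blast
  have fin: "finite A" "finite B" "finite D"
    unfolding A_def B_def D_def using finite_nbrs by auto
  have DA: "D \<subseteq> A" and DB: "D \<subseteq> B"
    unfolding A_def B_def D_def by (auto simp: nbrs_def not_adj_self)
  have rA: "int (card {t \<in> B. z \<rightarrow>\<^bsub>G\<^esub> t}) = r z" if "z \<in> A" for z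
    using card_nbrs_across_edge[OF xy, of z] that by (auto simp: A_def B_def D_def r_def)
  have rB: "int (card {z \<in> A. z \<rightarrow>\<^bsub>G\<^esub> t}) = r t" if "t \<in> B" for t
    using card_nbrs_across_edge[OF yx, of t] that
    by (auto simp: A_def B_def D_def r_def adj_sym[of _ t])
  \<comment> \<open>The weight \<open>r\<close> is the constant \<open>mu - 1\<close> corrected by
    \<open>lam - mu\<close> on \<open>D\<close>. The correction is the same for \<open>C = A\<close>
    and \<open>C = B\<close>, so it cancels in the difference.\<close>
  have split: "(\<Sum>z\<in>C. r z * g z) = (int mu - 1) * sum g C + (int lam - int mu) * sum g D"
    if "finite C" "D \<subseteq> C" for C and g :: "'a \<Rightarrow> int"
  proof -
    have "(\<Sum>z\<in>C. r z * g z) = (\<Sum>z\<in>C. (int mu - 1) * g z + (if z \<in> D then (int lam - int mu) * g z else 0))"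
      by (rule sum.cong) (auto simp: r_def algebra_simps)
    also have "\<dots> = (int mu - 1) * sum g C + (\<Sum>z\<in>C. if z \<in> D then (int lam - int mu) * g z else 0)"
      by (simp add: sum.distrib sum_distrib_left)
    also have "(\<Sum>z\<in>C. if z \<in> D then (int lam - int mu) * g z else 0) = (int lam - int mu) * sum g D"
      using that by (simp add: sum.If_cases Int_absorb1 sum_distrib_left)
    finally show ?thesis .
  qed
  \<comment> \<open>With this indicator the edges between \<open>A\<close> and \<open>B\<close> are
    counted by full double sums, whose row and column sums are both given by
    \<open>r\<close>.\<close>
  define e where "e z t = (if z \<rightarrow>\<^bsub>G\<^esub> t then 1 else 0 :: int)" for z t
  have eA: "(\<Sum>t\<in>B. e z t) = r z" if "z \<in> A" for z
    using rA[OF that] fin by (simp add: e_def sum.If_cases Int_def)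
  have eB: "(\<Sum>z\<in>A. e z t) = r t" if "t \<in> B" for t
    using rB[OF that] fin by (simp add: e_def sum.If_cases Int_def)
  have "(\<Sum>z\<in>A. \<Sum>t\<in>B. e z t * f t) = (\<Sum>t\<in>B. r t * f t)"
    by (subst sum.swap) (simp add: sum_distrib_right[symmetric] eB)
  moreover have "(\<Sum>z\<in>A. \<Sum>t\<in>B. e z t * f z) = (\<Sum>z\<in>A. r z * f z)"
    by (simp add: sum_distrib_right[symmetric] eA)
  moreover have "(\<Sum>z\<in>A. \<Sum>t\<in>B. e z t * f t) \<le> (\<Sum>z\<in>A. \<Sum>t\<in>B. e z t * f z + e z t)"
    using lip by (intro sum_mono) (auto simp: e_def)
  moreover have "(\<Sum>z\<in>A. \<Sum>t\<in>B. e z t) = (\<Sum>z\<in>A. r z * 1)"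
    by (simp add: eA)
  \<comment> \<open>The last term is the number of adjacent pairs, \<open>split\<close> for the
    constant function 1, where \<open>D\<close> has \<open>lam\<close> elements.\<close>
  ultimately have main: "(int mu - 1) * (sum f B - sum f A) \<le>
      (int mu - 1) * int (card A) + (int lam - int mu) * int lam"
    using split[OF fin(1) DA, of f] split[OF fin(2) DB, of f] split[OF fin(1) DA, of "\<lambda>_. 1"]
      card_common_nbrs_edge[OF xy] by (simp add: sum.distrib D_def algebra_simps)
  have verts: "x \<in> verts G" "y \<in> verts G"
    using xy adj_in_verts by auto
  have y: "y \<in> nbrs G x" and x: "x \<in> nbrs G y"
    using xy yx by (auto simp: nbrs_def)
  have cA: "int (card A) = int k - 1"
    using card.remove[OF finite_nbrs y] card_nbrs_eq[OF verts(1)] by (simp add: A_def)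
  have "laplacian G f x = f y + sum f A - int k * f x" "laplacian G f y = f x + sum f B - int k * f y"
    using sum.remove[OF finite_nbrs y, of f] sum.remove[OF finite_nbrs x, of f] verts
    by (simp_all add: laplacian_def sum_subtractf card_nbrs_eq A_def B_def)
  then have lap: "laplacian G f x - laplacian G f y = int k + 1 - (sum f B - sum f A)"
    using fy by (simp add: algebra_simps)
  show ?thesis
    using main unfolding lap cA by (simp add: algebra_simps)
qed

end

section \<open>Rounding, end estimates and the diameter\<close>

text \<open>The integer \<open>n - 2\<close> bounds the quotient, hence also its ceiling.\<close>

lemma two_plus_ceiling_divide_le:
  fixes n c :: int
  assumes "m > 0" "2 * m + c \<le> m * n"
  shows "2 + \<lceil>real_of_int c / real_of_int m\<rceil> \<le> n"
proof -
  have "real_of_int (2 * m + c) \<le> real_of_int (m * n)"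
    using assms(2) by (simp only: of_int_le_iff)
  then have "real_of_int c / real_of_int m \<le> real_of_int (n - 2)"
    using assms(1) by (simp add: field_simps)
  then show ?thesis by linarith
qed

text \<open>Each neighbour contributes at most 1, and each one in \<open>S\<close> at most -1, a
  loss of 2.\<close>

lemma (in graph) laplacian_le:
  assumes "S \<subseteq> nbrs G u" "\<And>w. w \<in> S \<Longrightarrow> f w \<le> f u - 1" "\<And>w. w \<in> nbrs G u \<Longrightarrow> f w \<le> f u + 1"
  shows "laplacian G f u \<le> int (card (nbrs G u)) - 2 * int (card S)"
proof -
  have "laplacian G f u \<le> (\<Sum>w\<in>nbrs G u. 1 - (if w \<in> S then 2 else 0))"
    unfolding laplacian_def using assms(2,3) by (intro sum_mono) (force simp: algebra_simps)
  also have "\<dots> = int (card (nbrs G u)) - 2 * int (card S)"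
    using assms(1) finite_nbrs by (simp add: sum_subtractf sum.If_cases Int_absorb1)
  finally show ?thesis .
qed

lemma laplacian_uminus: "laplacian G (\<lambda>w. - f w) u = - laplacian G f u"
  unfolding laplacian_def by (simp flip: sum_negf)

lemma graph_dist_le_diameter:
  assumes "u \<in> verts G" "w \<in> verts G"
  shows "graph_dist G u w \<le> diameter G"
  using assms unfolding diameter_def by (blast intro: SUP_upper2)

text \<open>If no distance equalled \<open>d\<close>, all would be at most \<open>d - 1\<close>, and
  so would their supremum. Since \<open>d > 0\<close>, the truncated subtraction is a genuine
  decrease.\<close>

lemma diameter_attainedE:
  assumes "diameter G = enat d" "d > 0"
  obtains u w where "u \<in> verts G" "w \<in> verts G" "graph_dist G u w = enat d"
proof (rule ccontr)
  assume "\<not> thesis"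
  with that have no: "\<forall>u\<in>verts G. \<forall>w\<in>verts G. graph_dist G u w \<noteq> enat d"
    by blast
  have "graph_dist G u w \<le> enat (d - 1)" if "u \<in> verts G" "w \<in> verts G" for u w
  proof -
    have "graph_dist G u w \<le> enat d"
      using graph_dist_le_diameter[OF that] assms(1) by simp
    moreover have "graph_dist G u w \<noteq> enat d"
      using no that by blast
    ultimately show ?thesis by (cases "graph_dist G u w") auto
  qed
  then have "diameter G \<le> enat (d - 1)"
    unfolding diameter_def by (intro SUP_least)
  then show False using assms by simp
qed

theorem corollary1p6:
  fixes G :: "('a, 'b) pre_digraph" and v k lam mu d :: nat
  assumes "amply_regular_graph G v k lam mu"
    and "connected G"
    and "diameter G = enat d"
    and "d \<ge> 4"
    and "mu \<noteq> 1"
    and "mu \<ge> lam"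
  shows "int d \<le>
    \<lfloor>2 * (real k - 2 * real mu) /
      (2 + real_of_int \<lceil>real lam * (real mu - real lam) / (real mu - 1)\<rceil>)\<rfloor> + 4"
proof -
  interpret amply_regular_graph G v k lam mu by fact
  obtain u w where u: "u \<in> verts G" and uw: "graph_dist G u w = enat d"
    by (rule diameter_attainedE[OF assms(3)]) (use assms(4) in auto)
  obtain x where x_dist: "\<And>i. i \<le> d \<Longrightarrow> graph_dist G u (x i) = enat i"
    and x_adj: "\<And>i. i < d \<Longrightarrow> x i \<rightarrow>\<^bsub>G\<^esub> x (Suc i)"
    using geodesicE[OF uw] by metis
  define f where "f z = int (the_enat (graph_dist G u z))" for z
  have fx: "f (x i) = int i" if "i \<le> d" for i
    using x_dist[OF that] by (simp add: f_def)
  \<comment> \<open>The finite diameter makes all distances from \<open>u\<close> to vertices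
    finite, so \<open>the_enat\<close> in \<open>f\<close> returns the actual distance
    there.\<close>
  have lip: "f t \<le> f z + 1" if "z \<rightarrow>\<^bsub>G\<^esub> t" for z t
  proof -
    have "graph_dist G u z \<le> enat d"
      using graph_dist_le_diameter[OF u] that assms(3) adj_in_verts(1) by metis
    then obtain n where n: "graph_dist G u z = enat n"
      by (cases "graph_dist G u z") auto
    from graph_dist_step[OF that n] obtain m where "graph_dist G u t = enat m" "m \<le> Suc n"
      by (cases "graph_dist G u t") auto
    with n show ?thesis by (simp add: f_def)
  qed
  have common: "card (nbrs G (x i) \<inter> nbrs G (x (i + 2))) = mu" if "i + 2 \<le> d" for i
  proof (rule card_common_nbrs_nonedge)
    show "x i \<rightarrow>\<^bsub>G\<^esub> x (Suc i)" "x (Suc i) \<rightarrow>\<^bsub>G\<^esub> x (i + 2)"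
      using x_adj[of i] x_adj[of "Suc i"] that by simp_all
    show "x i \<noteq> x (i + 2)"
      using fx[of i] fx[of "i + 2"] that by force
    show "\<not> x i \<rightarrow>\<^bsub>G\<^esub> x (i + 2)"
      using lip[of "x i" "x (i + 2)"] fx[of i] fx[of "i + 2"] that by force
  qed
  \<comment> \<open>The vertex \<open>x 1\<close> is a common neighbour of \<open>x 0\<close> and
    \<open>x 2\<close>, which excludes \<open>mu = 0\<close>.\<close>
  have mu: "mu > 1"
  proof -
    have "x 1 \<in> nbrs G (x 0) \<inter> nbrs G (x (0 + 2))"
      using x_adj[of 0] x_adj[of 1] adj_sym[of "x 1"] assms(4) by (auto simp: nbrs_def numeral_2_eq_2)
    then have "card (nbrs G (x 0) \<inter> nbrs G (x (0 + 2))) > 0"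
      using finite_nbrs by (auto simp: card_gt_0_iff)
    then show ?thesis
      using common[of 0] assms(4,5) by simp
  qed
  define K where "K = 2 + \<lceil>real lam * (real mu - real lam) / (real mu - 1)\<rceil>"
  have K: "K > 0"
  proof -
    have "0 \<le> real lam * (real mu - real lam) / (real mu - 1)"
      using mu assms(6) by (intro divide_nonneg_pos mult_nonneg_nonneg) auto
    then show ?thesis unfolding K_def by linarith
  qed
  \<comment> \<open>Rounding takes place on each edge, before summation, which puts the ceiling
    inside the denominator of the final bound.\<close>
  have step: "laplacian G f (x i) - laplacian G f (x (Suc i)) \<ge> K" if "i < d" for i
  proof -
    have "f (x (Suc i)) = f (x i) + 1" using fx[of i] fx[of "Suc i"] that by simp
    from two_plus_ceiling_divide_le[OF _ laplacian_diff_edge[of "x i" "x (Suc i)" f, OF x_adj[OF that] this lip]]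
    show ?thesis using mu by (simp add: K_def)
  qed
  \<comment> \<open>Telescoping along the geodesic; \<open>j = d - 4\<close> leads to
    \<open>x (d - 2)\<close>.\<close>
  have "2 + j \<le> d \<Longrightarrow> laplacian G f (x 2) - laplacian G f (x (2 + j)) \<ge> int j * K" for j
  proof (induction j)
    case (Suc j)
    then show ?case using step[of "2 + j"] by (simp add: algebra_simps)
  qed simp
  moreover have "2 + (d - 4) = d - 2" "int (d - 4) = int d - 4" "d - 2 \<le> d"
    using assms(4) by simp_all
  ultimately have drop:
    "laplacian G f (x 2) - laplacian G f (x (d - 2)) \<ge> (int d - 4) * K"
    by metis
  have xv: "x i \<in> verts G" if "i < d" for i
    using x_adj[OF that] adj_in_verts by blast
  have start: "laplacian G f (x 2) \<le> int k - 2 * int mu"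
  proof -
    have "laplacian G f (x 2) \<le> int (card (nbrs G (x 2))) - 2 * int (card (nbrs G (x 0) \<inter> nbrs G (x 2)))"
    proof (rule laplacian_le)
      \<comment> \<open>A neighbour of \<open>x 0\<close> has \<open>f\<close>-value at most 1, one
        below that of \<open>x 2\<close>.\<close>
      fix t assume "t \<in> nbrs G (x 0) \<inter> nbrs G (x 2)"
      then show "f t \<le> f (x 2) - 1"
        using lip[of "x 0" t] fx[of 0] fx[of 2] assms(4) by (simp add: nbrs_def)
    qed (auto simp: nbrs_def lip)
    then show ?thesis
      using common[of 0] card_nbrs_eq[OF xv[of 2]] assms(4) by (simp add: numeral_2_eq_2)
  qed
  have finish: "- laplacian G f (x (d - 2)) \<le> int k - 2 * int mu"
  proof -
    \<comment> \<open>Negating \<open>f\<close> turns the upper estimate into the lower one needed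
      here: neighbours of \<open>x d\<close> have \<open>f\<close>-value at least
      \<open>d - 1\<close>, one above that of \<open>x (d - 2)\<close>.\<close>
    have "laplacian G (\<lambda>z. - f z) (x (d - 2)) \<le> int (card (nbrs G (x (d - 2))))
        - 2 * int (card (nbrs G (x (d - 2)) \<inter> nbrs G (x d)))"
    proof (rule laplacian_le)
      fix t assume "t \<in> nbrs G (x (d - 2)) \<inter> nbrs G (x d)"
      then show "- f t \<le> - f (x (d - 2)) - 1"
        using lip[of t "x d"] adj_sym[of t "x d"] fx[of "d - 2"] fx[of d] assms(4)
        by (simp add: nbrs_def)
    next
      fix t assume "t \<in> nbrs G (x (d - 2))"
      then show "- f t \<le> - f (x (d - 2)) + 1"
        using lip[of t "x (d - 2)"] adj_sym[of t "x (d - 2)"] by (simp add: nbrs_def)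
    qed auto
    moreover have "card (nbrs G (x (d - 2)) \<inter> nbrs G (x d)) = mu"
      using common[of "d - 2"] assms(4) by (simp del: add_2_eq_Suc')
    ultimately show ?thesis
      using card_nbrs_eq[OF xv[of "d - 2"]] assms(4) by (simp add: laplacian_uminus)
  qed
  have "(int d - 4) * K \<le> 2 * (int k - 2 * int mu)"
    using order_trans[OF drop, of "2 * (int k - 2 * int mu)"] add_mono[OF start finish] by simp
  then have "real_of_int ((int d - 4) * K) \<le> real_of_int (2 * (int k - 2 * int mu))"
    by (simp only: of_int_le_iff)
  then have "real_of_int (int d - 4) \<le> 2 * (real k - 2 * real mu) / real_of_int K"
    using K by (simp add: pos_le_divide_eq)
  then have "int d - 4 \<le> \<lfloor>2 * (real k - 2 * real mu) / real_of_int K\<rfloor>"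
    by (simp only: le_floor_iff)
  then show ?thesis by (simp add: K_def)
qed

end
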